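(* Let $s>t\ge1$ and $r\ge2$ be integers. Then $L_{(s,t)}(n,r)=\Omega(n^h)$ as $n\to\infty$, where $$h=\max_{\substack{x\in\mathbb{Z}\\0\le x\le (s-t+1)r-1}} \min\left\{\frac{(s-t+1)r-x}{s-1},\frac{x+1}{s-t}\right\}.$$
   Context: An $r$-uniform hypergraph ($r$-graph) is a family (without repeated members) of $r$-element subsets, called edges, of a finite vertex set. For integers $s\ge t\ge1$, an $r$-graph is called locally $(s,t)$-thin if, among any $s$ distinct edges, at least $t$ of them contain a vertex that belongs to none of the other $s-1$ edges. $L_{(s,t)}(n,r)$ denotes the maximum number of edges in a locally $(s,t)$-thin $r$-graph on $n$ vertices. The parameters $s,t,r$ are fixed, and $\Omega(n^h)$ means at least $c\,n^h$ for all sufficiently large $n$, for some constant $c>0$ depending only on $s,t,r$. *)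

theory Defs
  imports Complex_Main "HOL-Library.Landau_Symbols"
begin

definition uniform_hypergraph :: "nat \<Rightarrow> 'a set \<Rightarrow> 'a set set \<Rightarrow> bool" where
  "uniform_hypergraph r V E \<longleftrightarrow> finite V \<and> (\<forall>e\<in>E. e \<subseteq> V \<and> card e = r)"

definition own_vertex :: "'a set set \<Rightarrow> 'a set \<Rightarrow> 'a \<Rightarrow> bool" where
  "own_vertex F e v \<longleftrightarrow> v \<in> e \<and> (\<forall>e'\<in>F - {e}. v \<notin> e')"

definition locally_thin :: "nat \<Rightarrow> nat \<Rightarrow> 'a set set \<Rightarrow> bool" where
  "locally_thin s t E \<longleftrightarrow>
     (\<forall>F. F \<subseteq> E \<and> finite F \<and> card F = s \<longrightarrow> card {e\<in>F. \<exists>v. own_vertex F e v} \<ge> t)"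

definition thin_sizes :: "nat \<Rightarrow> nat \<Rightarrow> nat \<Rightarrow> nat \<Rightarrow> nat set" where
  "thin_sizes s t n r =
     {card E |E :: nat set set. uniform_hypergraph r {..<n} E \<and> locally_thin s t E}"

text \<open>The vertex set is taken to be \<open>{..<n}\<close>; the notions above are invariant under
  renaming of vertices, so this loses no generality.\<close>

definition L :: "nat \<Rightarrow> nat \<Rightarrow> nat \<Rightarrow> nat \<Rightarrow> nat" where
  "L s t n r = Max (thin_sizes s t n r)"

lemma finite_thin_sizes: "finite (thin_sizes s t n r)"
proof (rule finite_subset)
  show "thin_sizes s t n r \<subseteq> card ` Pow (Pow {..<n})"
    by (auto simp: thin_sizes_def uniform_hypergraph_def)
qed simp

lemma thin_sizes_nonempty:
  assumes "s \<ge> 1"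
  shows "thin_sizes s t n r \<noteq> {}"
proof -
  have "uniform_hypergraph r {..<n} {}" "locally_thin s t ({} :: nat set set)"
    using assms by (auto simp: uniform_hypergraph_def locally_thin_def)
  then show ?thesis
    unfolding thin_sizes_def by blast
qed

definition thin_exponent :: "nat \<Rightarrow> nat \<Rightarrow> nat \<Rightarrow> real" where
  "thin_exponent s t r =
     Max ((\<lambda>x::int. min (((real s - real t + 1) * real r - of_int x) / (real s - 1))
                        ((of_int x + 1) / (real s - real t)))
          ` {0 .. (int s - int t + 1) * int r - 1})"

end

theory Submission
  imports Defs
begin

text \<open>
  Put \<open>p = s - t + 1\<close> and fix \<open>x\<close> attaining the maximum \<open>h\<close>. If \<open>s\<close> edges violate thinness,
  then \<open>p\<close> of them, forming a family \<open>A\<close>, have no own vertex, so every vertex of \<open>\<Union>A\<close> has degree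
  at least 2 and the union of all \<open>s\<close> edges has at most \<open>s r - card (\<Union>A)\<close> vertices. Hence a
  violation contains either \<open>p\<close> edges spanning fewer than \<open>p r - x\<close> vertices, or \<open>s\<close> edges
  spanning at most \<open>(t - 1) r + x\<close> vertices. The alteration method with edge density
  \<open>c n\<^sup>h\<^sup>-\<^sup>r\<close> yields an \<open>r\<close>-graph with \<open>\<Omega>(n\<^sup>h)\<close> edges that contains no configuration of either kind.
\<close>

section \<open>The deletion method, derandomized\<close>

text \<open>The method of conditional expectations for a random subset of \<open>Y\<close> of density \<open>q\<close>: the elements
  of \<open>S\<close> have already been accepted.\<close>

lemma derandomized_subset:
  fixes q :: real and Bs :: "'a set set"
  assumes q: "0 \<le> q" "q \<le> 1" and "finite Y" "finite S" "finite Bs" "S \<inter> Y = {}"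
  shows "\<exists>S'. S' \<subseteq> S \<union> Y \<and>
    real (card S) + q * real (card Y) - (\<Sum>B\<in>Bs. if B \<subseteq> S \<union> Y then q ^ card (B \<inter> Y) else 0)
      \<le> real (card S') - real (card {B\<in>Bs. B \<subseteq> S'})"
  using assms(3,4,6)
proof (induction Y arbitrary: S rule: finite_induct)
  case empty
  have "(\<Sum>B\<in>Bs. if B \<subseteq> S \<union> {} then q ^ card (B \<inter> {}) else 0) = real (card {B\<in>Bs. B \<subseteq> S})"
    using \<open>finite Bs\<close> by (simp add: sum.If_cases Int_def cong: if_cong)
  then show ?case
    by (intro exI[of _ S]) (simp del: Int_empty_right Un_empty_right)
next
  case (insert a Y)
  \<comment> \<open>If each element of \<open>Y\<close> is kept independently with probability
    \<open>q\<close>, then \<open>w S Y B\<close> is the probability that \<open>B\<close> survives,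
    and \<open>g S Y\<close> is the expected size of the outcome minus the expected number of
    surviving members of \<open>Bs\<close>.\<close>
  define w where "w S Y B = (if B \<subseteq> S \<union> Y then q ^ card (B \<inter> Y) else 0)" for S Y and B :: "'a set"
  define g where "g S Y = real (card S) + q * real (card Y) - (\<Sum>B\<in>Bs. w S Y B)" for S Y
  have a: "a \<notin> S" "a \<notin> Y" "S \<inter> Y = {}"
    using insert by auto
  have "w S (insert a Y) B = (1 - q) * w S Y B + q * w (insert a S) Y B" for B
  proof (cases "a \<in> B")
    case True
    then have "B \<inter> insert a Y = insert a (B \<inter> Y)" by auto
    then have "card (B \<inter> insert a Y) = Suc (card (B \<inter> Y))"
      using a insert(1) by simp
    moreover have "\<not> B \<subseteq> S \<union> Y" using True a by auto
    ultimately show ?thesis by (simp add: w_def)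
  next
    case False
    then have "B \<inter> insert a Y = B \<inter> Y" "B \<subseteq> S \<union> insert a Y \<longleftrightarrow> B \<subseteq> S \<union> Y"
      "B \<subseteq> insert a S \<union> Y \<longleftrightarrow> B \<subseteq> S \<union> Y" by auto
    then show ?thesis by (simp add: w_def algebra_simps)
  qed
  then have "(\<Sum>B\<in>Bs. w S (insert a Y) B)
      = (1 - q) * (\<Sum>B\<in>Bs. w S Y B) + q * (\<Sum>B\<in>Bs. w (insert a S) Y B)"
    by (simp add: sum.distrib sum_distrib_left)
  then have avg: "g S (insert a Y) = (1 - q) * g S Y + q * g (insert a S) Y"
    using a insert(1,4) by (simp add: g_def algebra_simps)
  \<comment> \<open>One of the two decisions about \<open>a\<close> does at least as well as their
    average: case 1 rejects \<open>a\<close>, case 2 accepts it.\<close>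
  have "g S (insert a Y) \<le> max (g S Y) (g (insert a S) Y)"
    unfolding avg using q by (intro convex_bound_le) auto
  then consider "g S (insert a Y) \<le> g S Y" | "g S (insert a Y) \<le> g (insert a S) Y"
    by linarith
  then show ?case
  proof cases
    case 1
    obtain S' where "S' \<subseteq> S \<union> Y" "g S Y \<le> real (card S') - real (card {B\<in>Bs. B \<subseteq> S'})"
      using insert.IH[of S] insert.prems a unfolding g_def w_def by auto
    with 1 show ?thesis
      unfolding g_def w_def by (intro exI[of _ S']) auto
  next
    case 2
    obtain S' where "S' \<subseteq> insert a S \<union> Y"
        "g (insert a S) Y \<le> real (card S') - real (card {B\<in>Bs. B \<subseteq> S'})"
      using insert.IH[of "insert a S"] insert.prems a unfolding g_def w_def by auto
    with 2 show ?thesis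
      unfolding g_def w_def by (intro exI[of _ S']) auto
  qed
qed

text \<open>Start the derandomized choice with nothing accepted, then delete one element from each
  bad set that survived. Each deletion is already paid for by the subtracted count of surviving bad
  sets.\<close>

lemma alteration:
  fixes q :: real and Bs :: "'a set set"
  assumes q: "0 \<le> q" "q \<le> 1" and X: "finite X"
    and Bs: "\<And>B. B \<in> Bs \<Longrightarrow> B \<subseteq> X \<and> B \<noteq> {}"
  shows "\<exists>E\<subseteq>X. (\<forall>B\<in>Bs. \<not> B \<subseteq> E) \<and>
    q * real (card X) - (\<Sum>B\<in>Bs. q ^ card B) \<le> real (card E)"
proof -
  have fin: "finite Bs"
    by (rule finite_subset[of _ "Pow X"]) (use X Bs in auto)
  have "(\<Sum>B\<in>Bs. if B \<subseteq> {} \<union> X then q ^ card (B \<inter> X) else 0) = (\<Sum>B\<in>Bs. q ^ card B)"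
    using Bs by (intro sum.cong) (auto simp: Int_absorb2)
  then obtain S where S: "S \<subseteq> X"
    "q * real (card X) - (\<Sum>B\<in>Bs. q ^ card B) \<le> real (card S) - real (card {B\<in>Bs. B \<subseteq> S})"
    using derandomized_subset[OF q X, of "{}" Bs] fin by auto
  define pick where "pick B = (SOME b. b \<in> B)" for B :: "'a set"
  have pick: "pick B \<in> B" if "B \<in> Bs" for B
    using Bs[OF that] unfolding pick_def by (simp add: some_in_eq)
  define D where "D = pick ` {B\<in>Bs. B \<subseteq> S}"
  have "card D \<le> card {B\<in>Bs. B \<subseteq> S}"
    unfolding D_def using fin by (intro card_image_le) auto
  moreover have "card S \<le> card (S - D) + card D"
    using diff_card_le_card_Diff[of D S] fin by (auto simp: D_def)
  moreover have "\<not> B \<subseteq> S - D" if "B \<in> Bs" for B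
    using pick[OF that] that by (auto simp: D_def)
  ultimately show ?thesis
    using S by (intro exI[of _ "S - D"]) auto
qed

section \<open>Thinness from forbidden dense configurations\<close>

text \<open>Double counting of incidences: each vertex of \<open>\<Union>F\<close> has degree at
  least 1, and each vertex of \<open>\<Union>A\<close> lies in a second edge of \<open>F\<close>,
  since it is no edge's own vertex. That second edge need not belong to \<open>A\<close>.\<close>

lemma own_vertexless_spread:
  assumes "finite F" and card_r: "\<And>e. e \<in> F \<Longrightarrow> finite e \<and> card e = r" and "A \<subseteq> F"
    and no_own: "\<And>e v. e \<in> A \<Longrightarrow> \<not> own_vertex F e v"
  shows "card (\<Union>F) + card (\<Union>A) \<le> card F * r"
proof -
  let ?deg = "\<lambda>v. card {e\<in>F. v \<in> e}"
  have finU: "finite (\<Union>F)" using assms by auto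
  have "card F * r = (\<Sum>e\<in>F. card e)"
    using card_r by simp
  also have "\<dots> = (\<Sum>e\<in>F. \<Sum>v | v \<in> \<Union>F \<and> v \<in> e. 1)"
    by (intro sum.cong refl) (auto intro!: arg_cong[where f = card])
  also have "\<dots> = (\<Sum>v\<in>\<Union>F. ?deg v)"
    using sum.swap_restrict[OF \<open>finite F\<close> finU, of "\<lambda>_ _. 1::nat" "\<lambda>e v. v \<in> e"] by simp
  finally have deg_sum: "card F * r = (\<Sum>v\<in>\<Union>F. ?deg v)" .
  have "(if v \<in> \<Union>A then 2 else 1) \<le> ?deg v" if v: "v \<in> \<Union>F" for v
  proof (cases "v \<in> \<Union>A")
    case True
    then obtain e where e: "e \<in> A" "v \<in> e" by auto
    then obtain e' where "e' \<in> F" "e' \<noteq> e" "v \<in> e'"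
      using no_own[OF e(1), of v] unfolding own_vertex_def by auto
    with e \<open>A \<subseteq> F\<close> have "{e, e'} \<subseteq> {e\<in>F. v \<in> e}" "card {e, e'} = 2" by auto
    then show ?thesis
      using card_mono[of "{e\<in>F. v \<in> e}" "{e, e'}"] \<open>finite F\<close> True by simp
  next
    case False
    have "{e\<in>F. v \<in> e} \<noteq> {}" using v by auto
    then have "0 < ?deg v" using \<open>finite F\<close> by (simp only: card_gt_0_iff) auto
    then show ?thesis using False by simp
  qed
  then have "(\<Sum>v\<in>\<Union>F. if v \<in> \<Union>A then 2 else 1) \<le> card F * r"
    unfolding deg_sum by (rule sum_mono)
  moreover have "(\<Sum>v\<in>\<Union>F. if v \<in> \<Union>A then 2 else 1::nat)
      = (\<Sum>v\<in>\<Union>F. 1 + (if v \<in> \<Union>A then 1 else 0))"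
    by (intro sum.cong) auto
  moreover have "\<dots> = card (\<Union>F) + card (\<Union>F \<inter> \<Union>A)"
    using finU by (simp only: sum.distrib sum.If_cases) (simp add: Int_def)
  moreover have "\<Union>F \<inter> \<Union>A = \<Union>A" using \<open>A \<subseteq> F\<close> by auto
  ultimately show ?thesis by simp
qed

definition compact_families :: "nat \<Rightarrow> nat \<Rightarrow> nat \<Rightarrow> 'a set \<Rightarrow> 'a set set set" where
  "compact_families r j v V =
     {F. (\<forall>e\<in>F. e \<subseteq> V \<and> card e = r) \<and> card F = j \<and> card (\<Union>F) \<le> v}"

text \<open>The parameter \<open>x\<close> balances two ways to fail: if the edges without own
  vertices span at least \<open>(s - t + 1) * r - x\<close> vertices, the incidence count leaves at
  most \<open>(t - 1) * r + x\<close> for all \<open>s\<close> edges.\<close>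

lemma locally_thin_if_no_compact_families:
  fixes x :: nat
  assumes t: "1 \<le> t" "t < s" and x: "x < (s - t + 1) * r"
    and E: "uniform_hypergraph r V E"
    and no1: "\<And>F. F \<subseteq> E \<Longrightarrow> F \<notin> compact_families r (s - t + 1) ((s - t + 1) * r - x - 1) V"
    and no2: "\<And>F. F \<subseteq> E \<Longrightarrow> F \<notin> compact_families r s ((t - 1) * r + x) V"
  shows "locally_thin s t E"
  unfolding locally_thin_def
proof (intro allI impI, rule ccontr)
  fix F assume F: "F \<subseteq> E \<and> finite F \<and> card F = s"
    and few: "\<not> t \<le> card {e\<in>F. \<exists>v. own_vertex F e v}"
  let ?O = "{e\<in>F. \<exists>v. own_vertex F e v}"
  have "card (F - ?O) = s - card ?O"
    using F by (subst card_Diff_subset) auto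
  then have "s - t + 1 \<le> card (F - ?O)" using few t by linarith
  then obtain A where A: "A \<subseteq> F - ?O" "card A = s - t + 1"
    by (meson obtain_subset_with_card_n)
  have edges: "finite e \<and> e \<subseteq> V \<and> card e = r" if "e \<in> F" for e
    using that F E unfolding uniform_hypergraph_def by (meson finite_subset subsetD)
  have "A \<notin> compact_families r (s - t + 1) ((s - t + 1) * r - x - 1) V"
    using A F by (intro no1) auto
  then have "(s - t + 1) * r - x - 1 < card (\<Union>A)"
    using A edges unfolding compact_families_def by force
  then have 1: "(s - t + 1) * r - x \<le> card (\<Union>A)" using x by linarith
  have "F \<notin> compact_families r s ((t - 1) * r + x) V"
    using F by (intro no2) auto
  then have 2: "(t - 1) * r + x < card (\<Union>F)"
    using F edges unfolding compact_families_def by force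
  have 3: "card (\<Union>F) + card (\<Union>A) \<le> card F * r"
    using F A edges by (intro own_vertexless_spread) auto
  have "s = (s - t + 1) + (t - 1)" using t by simp
  then have "card F * r = (s - t + 1) * r + (t - 1) * r"
    using F by (metis add_mult_distrib)
  then show False using 1 2 3 x by linarith
qed

section \<open>Counting the forbidden configurations\<close>

lemma card_compact_families_le:
  fixes V :: "'a set"
  assumes V: "finite V" "v \<le> card V"
  shows "card (compact_families r j v V) \<le> card V ^ v * 2 ^ 2 ^ v"
proof -
  let ?U = "{U. U \<subseteq> V \<and> card U = v}"
  have "compact_families r j v V \<subseteq> (\<Union>U\<in>?U. Pow (Pow U))"
  proof
    fix F assume F: "F \<in> compact_families r j v V"
    then have "\<Union>F \<subseteq> V" "card (\<Union>F) \<le> v" by (auto simp: compact_families_def)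
    \<comment> \<open>Padding the union to exactly \<open>v\<close> vertices, possible as
      \<open>v \<le> card V\<close>, leaves only \<open>v\<close>-subsets to count; the families
      inside one of them number at most a constant independent of \<open>V\<close>.\<close>
    then obtain U where "\<Union>F \<subseteq> U" "U \<subseteq> V" "card U = v"
      using exists_subset_between[of "\<Union>F" v V] V by auto
    then show "F \<in> (\<Union>U\<in>?U. Pow (Pow U))" by auto
  qed
  then have "card (compact_families r j v V) \<le> card (\<Union>U\<in>?U. Pow (Pow U))"
    using V(1) by (intro card_mono) (auto intro: finite_subset)
  also have "\<dots> \<le> (\<Sum>U\<in>?U. card (Pow (Pow U)))"
    using V(1) by (intro card_UN_le) auto
  also have "\<dots> = (\<Sum>U\<in>?U. 2 ^ 2 ^ v)"
    using V(1) by (intro sum.cong) (auto simp: card_Pow finite_subset)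
  also have "\<dots> = (card V choose v) * 2 ^ 2 ^ v"
    using n_subsets[OF V(1), of v] by simp
  also have "\<dots> \<le> card V ^ v * 2 ^ 2 ^ v"
    using binomial_le_pow[OF V(2)] by simp
  finally show ?thesis .
qed

text \<open>The left side is the expected number of compact families at edge density
  \<open>c * real n powr (h - real r)\<close>. The hypothesis on \<open>h\<close> says exactly that
  the exponent \<open>v + j * (h - r)\<close> is at most \<open>h\<close>, and
  \<open>2 \<le> j\<close> yields the factor \<open>c\<^sup>2\<close>, which a small
  \<open>c\<close> makes negligible against the linear gain.\<close>

lemma card_compact_families_weight_le:
  fixes c h :: real
  assumes n: "1 \<le> n" "v \<le> n" and c: "0 < c" "c \<le> 1" and "2 \<le> j"
    and h: "h * (real j - 1) \<le> real j * real r - real v"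
  shows "real (card (compact_families r j v {..<n})) * (c * real n powr (h - real r)) ^ j
    \<le> c\<^sup>2 * 2 ^ 2 ^ v * real n powr h"
proof -
  have "real (card (compact_families r j v {..<n})) \<le> real (n ^ v * 2 ^ 2 ^ v)"
    using card_compact_families_le[of "{..<n}" v r j] n by (simp only: of_nat_le_iff) simp
  then have 1: "real (card (compact_families r j v {..<n})) \<le> real n powr real v * 2 ^ 2 ^ v"
    using n by (simp add: powr_realpow)
  have 2: "(c * real n powr (h - real r)) ^ j = c ^ j * real n powr (real j * (h - real r))"
    using n by (simp add: power_mult_distrib powr_power mult.commute)
  have "real v + real j * (h - real r) \<le> h"
    using h by (simp add: algebra_simps)
  then have 3: "real n powr real v * real n powr (real j * (h - real r)) \<le> real n powr h"
    using n by (simp flip: powr_add add: powr_mono)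
  have 4: "c ^ j \<le> c\<^sup>2" using c \<open>2 \<le> j\<close> by (intro power_decreasing) auto
  have "real (card (compact_families r j v {..<n})) * (c * real n powr (h - real r)) ^ j
     \<le> (real n powr real v * 2 ^ 2 ^ v) * (c ^ j * real n powr (real j * (h - real r)))"
    unfolding 2 using 1 c by (intro mult_right_mono) auto
  also have "\<dots> = c ^ j * 2 ^ 2 ^ v * (real n powr real v * real n powr (real j * (h - real r)))"
    by simp
  also have "\<dots> \<le> c\<^sup>2 * 2 ^ 2 ^ v * real n powr h"
    using 3 4 c by (intro mult_mono) auto
  finally show ?thesis .
qed

section \<open>The lower bound and the choice of parameters\<close>

text \<open>The expected number of edges contributes at least \<open>c / r ^ r\<close> times
  \<open>n powr h\<close>; the two kinds of forbidden families cost at most the terms with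
  \<open>c\<^sup>2\<close>.\<close>

lemma L_lower_bound:
  fixes x :: nat and c h :: real
  assumes t: "1 \<le> t" "t < s" and r: "1 \<le> r" and x: "x < (s - t + 1) * r"
    and h1: "h * real (s - t) \<le> real x + 1"
    and h2: "h * (real s - 1) \<le> real ((s - t + 1) * r) - real x"
    and "h \<le> real r"
    and c: "0 < c" "c \<le> 1"
    and n: "(s - t + 1) * r - x - 1 \<le> n" "(t - 1) * r + x \<le> n" "r \<le> n"
  shows "c * (1 / real r ^ r - c * (2 ^ 2 ^ ((s - t + 1) * r - x - 1) + 2 ^ 2 ^ ((t - 1) * r + x)))
      * real n powr h \<le> real (L s t n r)"
proof -
  define v1 where "v1 = (s - t + 1) * r - x - 1"
  define v2 where "v2 = (t - 1) * r + x"
  define q where "q = c * real n powr (h - real r)"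
  define X where "X = {e. e \<subseteq> {..<n} \<and> card e = r}"
  define B1 where "B1 = compact_families r (s - t + 1) v1 {..<n}"
  define B2 where "B2 = compact_families r s v2 {..<n}"
  have n1: "1 \<le> n" using n r by linarith
  \<comment> \<open>This is where \<open>h \<le> real r\<close> enters: the density has to be a
    probability.\<close>
  have "real n powr (h - real r) \<le> 1"
    using n1 \<open>h \<le> real r\<close> powr_mono[of "h - real r" 0 "real n"] by simp
  then have q: "0 \<le> q" "q \<le> 1"
    using c mult_mono[of c 1 "real n powr (h - real r)" 1] by (auto simp: q_def)
  have finX: "finite X" by (simp add: X_def)
  have sub: "B1 \<union> B2 \<subseteq> Pow X"
    by (auto simp: B1_def B2_def X_def compact_families_def)
  then have finB: "finite B1" "finite B2"
    using finX by (auto intro: finite_subset)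
  have card_B: "card B = s - t + 1" if "B \<in> B1" for B
    using that by (simp add: B1_def compact_families_def)
  have card_B': "card B = s" if "B \<in> B2" for B
    using that by (simp add: B2_def compact_families_def)
  have "\<exists>E\<subseteq>X. (\<forall>B\<in>B1 \<union> B2. \<not> B \<subseteq> E) \<and>
      q * real (card X) - (\<Sum>B\<in>B1 \<union> B2. q ^ card B) \<le> real (card E)"
  proof (rule alteration[OF q finX])
    fix B assume "B \<in> B1 \<union> B2"
    then show "B \<subseteq> X \<and> B \<noteq> {}"
      using sub card_B[of B] card_B'[of B] t by auto
  qed
  then obtain E where E: "E \<subseteq> X" "\<And>B. B \<in> B1 \<union> B2 \<Longrightarrow> \<not> B \<subseteq> E"
    "q * real (card X) - (\<Sum>B\<in>B1 \<union> B2. q ^ card B) \<le> real (card E)"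
    by blast
  have unif: "uniform_hypergraph r {..<n} E"
    using E(1) by (auto simp: uniform_hypergraph_def X_def)
  have "locally_thin s t E"
    using E(2) by (intro locally_thin_if_no_compact_families[OF t x unif])
      (auto simp: B1_def B2_def v1_def v2_def)
  then have "card E \<in> thin_sizes s t n r"
    using unif by (auto simp: thin_sizes_def)
  then have L: "card E \<le> L s t n r"
    unfolding L_def by (intro Max_ge finite_thin_sizes)
  have "(\<Sum>B\<in>B1 \<union> B2. q ^ card B) \<le> (\<Sum>B\<in>B1. q ^ card B) + (\<Sum>B\<in>B2. q ^ card B)"
    using finB q by (subst sum.union_inter[symmetric]) (auto intro!: sum_nonneg)
  also have "\<dots> = real (card B1) * q ^ (s - t + 1) + real (card B2) * q ^ s"
    using card_B card_B' by simp
  also have "\<dots> \<le> c\<^sup>2 * 2 ^ 2 ^ v1 * real n powr h + c\<^sup>2 * 2 ^ 2 ^ v2 * real n powr h"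
  proof (rule add_mono)
    \<comment> \<open>As \<open>x < (s - t + 1) * r\<close>, the natural subtraction is exact. With
      \<open>j = s - t + 1\<close> the exponent condition becomes \<open>h1\<close>; below, with
      \<open>j = s\<close>, it becomes \<open>h2\<close>.\<close>
    have "real v1 = real ((s - t + 1) * r) - real x - 1"
      using x by (simp add: v1_def of_nat_diff)
    then show "real (card B1) * q ^ (s - t + 1) \<le> c\<^sup>2 * 2 ^ 2 ^ v1 * real n powr h"
      unfolding B1_def q_def using n n1 c t h1
      by (intro card_compact_families_weight_le) (auto simp: v1_def algebra_simps of_nat_diff)
    have "s = (s - t + 1) + (t - 1)" using t by simp
    then have "s * r = (s - t + 1) * r + (t - 1) * r"
      by (metis add_mult_distrib)
    then have "real s * real r = real ((s - t + 1) * r) + real ((t - 1) * r)"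
      by (metis of_nat_add of_nat_mult)
    then show "real (card B2) * q ^ s \<le> c\<^sup>2 * 2 ^ 2 ^ v2 * real n powr h"
      unfolding B2_def q_def using n n1 c t h2
      by (intro card_compact_families_weight_le) (auto simp: v2_def)
  qed
  finally have bad: "(\<Sum>B\<in>B1 \<union> B2. q ^ card B) \<le> c\<^sup>2 * (2 ^ 2 ^ v1 + 2 ^ 2 ^ v2) * real n powr h"
    by (simp add: algebra_simps)
  have "(real n / real r) ^ r \<le> real (card X)"
    using binomial_ge_n_over_k_pow_k[OF n(3), where 'a = real] n_subsets[of "{..<n}" r]
    by (simp add: X_def)
  then have "q * (real n / real r) ^ r \<le> q * real (card X)"
    using q by (intro mult_left_mono)
  moreover have "q * (real n / real r) ^ r = c * (1 / real r ^ r) * real n powr h"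
    using n1 by (simp add: q_def power_divide powr_diff powr_realpow)
  ultimately have "c * (1 / real r ^ r) * real n powr h
      - c\<^sup>2 * (2 ^ 2 ^ v1 + 2 ^ 2 ^ v2) * real n powr h \<le> real (card E)"
    using bad E(3) by linarith
  then show ?thesis
    using L unfolding v1_def[symmetric] v2_def[symmetric]
    by (simp add: algebra_simps power2_eq_square)
qed

text \<open>A maximum over a finite nonempty integer range is attained; clearing denominators at a
  maximizer gives the two exponent conditions, with \<open>x\<close> a natural number.\<close>

lemma thin_exponent_attained:
  assumes "1 \<le> t" "t < s" "1 \<le> r"
  obtains x :: nat where "x < (s - t + 1) * r"
    and "thin_exponent s t r * real (s - t) \<le> real x + 1"
    and "thin_exponent s t r * (real s - 1) \<le> real ((s - t + 1) * r) - real x"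
proof -
  define f where "f = (\<lambda>x::int. min (((real s - real t + 1) * real r - of_int x) / (real s - 1))
    ((of_int x + 1) / (real s - real t)))"
  have p: "(int s - int t + 1) * int r = int ((s - t + 1) * r)"
    using assms by (simp only: of_nat_mult of_nat_add of_nat_diff less_imp_le of_nat_1)
  have "0 < (s - t + 1) * r" using assms by simp
  then have "0 \<le> int ((s - t + 1) * r) - 1" by linarith
  then have "{0 .. int ((s - t + 1) * r) - 1} \<noteq> {}" by (metis atLeastAtMost_iff empty_iff order_refl)
  then have "thin_exponent s t r \<in> f ` {0 .. int ((s - t + 1) * r) - 1}"
    unfolding thin_exponent_def f_def[symmetric] p by (intro Max_in) auto
  then obtain y where y: "0 \<le> y" "y < int ((s - t + 1) * r)" "thin_exponent s t r = f y"
    by auto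
  have "f y \<le> ((real s - real t + 1) * real r - of_int y) / (real s - 1)"
    "f y \<le> (of_int y + 1) / (real s - real t)"
    by (simp_all add: f_def)
  then have "f y * (real s - real t) \<le> of_int y + 1"
    "f y * (real s - 1) \<le> (real s - real t + 1) * real r - of_int y"
    using assms by (simp_all add: pos_le_divide_eq)
  moreover have "nat y < (s - t + 1) * r"
    using y(1,2) by linarith
  ultimately show ?thesis
    using y assms by (intro that[of "nat y"]) (auto simp: of_nat_diff algebra_simps)
qed

theorem theorem1p2:
  fixes s t r :: nat
  assumes "t \<ge> 1" and "s > t" and "r \<ge> 2"
  shows "(\<lambda>n::nat. real (L s t n r)) \<in> \<Omega>(\<lambda>n. real n powr thin_exponent s t r)"
proof -
  define h where "h = thin_exponent s t r"
  obtain x where x: "x < (s - t + 1) * r" "h * real (s - t) \<le> real x + 1"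
    "h * (real s - 1) \<le> real ((s - t + 1) * r) - real x"
    using thin_exponent_attained[of t s r] assms unfolding h_def by auto
  \<comment> \<open>If \<open>h > r\<close>, the first condition on \<open>h\<close> forces
    \<open>x \<ge> r * (s - t)\<close>, hence \<open>x \<ge> r\<close>, while the second forces
    \<open>x < r\<close>.\<close>
  have "h \<le> real r"
  proof (rule ccontr)
    assume "\<not> h \<le> real r"
    then have hr: "real r < h" by simp
    have "real r * real (s - t) < real x + 1"
      using hr x(2) assms mult_strict_right_mono[of "real r" h "real (s - t)"] by linarith
    then have "real (r * (s - t)) < real (x + 1)" by simp
    then have 1: "r * (s - t) \<le> x" by linarith
    have "real r * (real s - 1) < real ((s - t + 1) * r) - real x"
      using hr x(3) assms mult_strict_right_mono[of "real r" h "real s - 1"] by linarith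
    moreover have "real s - 1 \<ge> real (s - t)" using assms by (simp add: of_nat_diff)
    then have "real r * real (s - t) \<le> real r * (real s - 1)" by (intro mult_left_mono) auto
    ultimately have "real (r * (s - t) + x) < real ((s - t + 1) * r)"
      by (simp add: mult.commute)
    then have "r * (s - t) + x < (s - t + 1) * r" by linarith
    then have "x < r" by (simp add: algebra_simps)
    moreover have "r * 1 \<le> r * (s - t)" using assms by (intro mult_left_mono) auto
    ultimately show False using 1 by simp
  qed
  define K :: real where "K = 2 ^ 2 ^ ((s - t + 1) * r - x - 1) + 2 ^ 2 ^ ((t - 1) * r + x)"
  \<comment> \<open>This \<open>c\<close> makes the loss \<open>c * K\<close> exactly half of the
    gain \<open>1 / real r ^ r\<close>.\<close>
  define c where "c = 1 / (2 * K * real r ^ r)"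
  have "1 \<le> K"
    unfolding K_def by (rule add_increasing2) auto
  moreover have "1 \<le> real r ^ r" using assms by (intro one_le_power) auto
  ultimately have "1 \<le> K * real r ^ r"
    using mult_mono[of 1 K 1 "real r ^ r"] by simp
  then have c: "0 < c" "c \<le> 1" by (auto simp: c_def)
  have cK: "1 / real r ^ r - c * K = 1 / (2 * real r ^ r)"
    using \<open>1 \<le> K\<close> assms by (simp add: c_def field_simps)
  define d where "d = c * (1 / (2 * real r ^ r))"
  have d: "0 < d" using c assms by (simp add: d_def)
  have "d * real n powr h \<le> real (L s t n r)"
    \<comment> \<open>The sum dominates all three lower bounds on \<open>n\<close> required by
      \<open>L_lower_bound\<close>.\<close>
    if "n \<ge> (s - t + 1) * r + (t - 1) * r + x + r" for n
  proof -
    have "c * (1 / real r ^ r - c * K) * real n powr h \<le> real (L s t n r)"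
      unfolding K_def
      using that assms x c \<open>h \<le> real r\<close> by (intro L_lower_bound) auto
    then show ?thesis unfolding cK d_def .
  qed
  then have "\<forall>\<^sub>F n in at_top. d * norm (real n powr h) \<le> norm (real (L s t n r))"
    by (intro eventually_at_top_linorderI[of "(s - t + 1) * r + (t - 1) * r + x + r"]) simp
  then show ?thesis
    unfolding h_def[symmetric] by (rule landau_omega.bigI[OF d])
qed

end
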